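(* Let $\mathbb{A}$ be a set of possible actions, $K$ a positive integer (the horizon length), and $f:\mathbb{A}^*\to\mathbb{R}$ an objective function. Consider the problem of maximizing $f(M)$ subject to $M\in\mathbb{A}^*$, $|M|\le K$. Let $O_K=(o_1,\ldots,o_K)$ be an optimal strategy of length $K$ and $G_K=(g_1,\ldots,g_K)$ a greedy strategy, and let $\eta\in(0,1]$ be the curvature $$\eta=\max_{1\le i\le K-1}\left\{\frac{Kf(G_i)-\bigl(Kf(G_i\oplus\bar O_{K-i})-(K-i)f(O_K)\bigr)}{(K-i)f(G_i)}\right\}.$$ If $f$ is $K$-submodular and $K$-GO-concave, then $$f(G_K)\ \ge\ \frac1\eta\left(1-\left(1-\frac{\eta}{K}\right)^K\right)f(O_K)\ >\ \frac1\eta\left(1-e^{-\eta}\right)f(O_K).$$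
   Context: $\mathbb{A}^*$ denotes the set of all finite strings $(a_1,\ldots,a_k)$ of elements of $\mathbb{A}$ of arbitrary length, including the empty string $\varnothing$; $|M|$ is the length of the string $M$; $M\oplus N$ is the concatenation of $M$ followed by $N$; $M\preceq N$ means $N=M\oplus L$ for some $L\in\mathbb{A}^*$ ($M$ is a prefix of $N$). An optimal strategy is any solution of the problem of maximizing $f(M)$ over $M\in\mathbb{A}^*$ with $|M|\le K$; $O_K=(o_1,\ldots,o_K)$ denotes an optimal strategy of length $K$. A greedy strategy is a string $G_K=(g_1,\ldots,g_K)$ such that for every $i=1,\ldots,K$, $g_i\in\operatorname{argmax}_{g\in\mathbb{A}} f((g_1,\ldots,g_{i-1},g))$. Write $G_i=(g_1,\ldots,g_i)$ and $\bar O_{K-i}=(o_{i+1},\ldots,o_K)$. $f$ is $K$-monotone if $f(M\oplus N)\ge f(M)$ for all $M,N\in\mathbb{A}^*$ with $|M|+|N|\le K$. $f$ is $K$-diminishing if $f(M\oplus(a))-f(M)\ge f(N\oplus(a))-f(N)$ for all $M\preceq N$ in $\mathbb{A}^*$ with $|N|\le K-1$ and all $a\in\mathbb{A}$. $f$ is $K$-submodular if it is both $K$-monotone and $K$-diminishing. $f$ is $K$-GO-concave if for all $1\le i\le K-1$, $$f(G_i\oplus\bar O_{K-i})\ \ge\ \frac iK f(G_i)+\left(1-\frac iK\right)f(O_K).$$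
   Formalization: The added hypothesis f(∅) ≥ 0 is needed: with K = 2, f(∅) = −1, every one-letter string 1, f(ab) = 3 and all other pairs 2, O = (a,b), G = (g,a), η = 1, all other hypotheses hold but f(G_2) = 2 < 9/4. *)

theory Defs
  imports Complex_Main "HOL-Library.Sublist"
begin

text \<open>
  Strings over the action set \<open>A\<close> are the elements of \<^term>\<open>lists A\<close>. For a strategy
  \<open>gs = (g\<^sub>1, \<dots>, g\<^sub>K)\<close> the string \<open>G\<^sub>i\<close> is \<^term>\<open>take i gs\<close>, and for
  \<open>os = (o\<^sub>1, \<dots>, o\<^sub>K)\<close> the string \<open>(o\<^sub>i\<^sub>+\<^sub>1, \<dots>, o\<^sub>K)\<close> is \<^term>\<open>drop i os\<close>.
\<close>

definition optimal_strategy :: "'a set \<Rightarrow> ('a list \<Rightarrow> real) \<Rightarrow> nat \<Rightarrow> 'a list \<Rightarrow> bool" where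
  "optimal_strategy A f K os \<longleftrightarrow> is_arg_max f (\<lambda>M. M \<in> lists A \<and> length M \<le> K) os"

text \<open>Zero-based indexing: \<^term>\<open>gs ! i\<close> is \<open>g\<^sub>i\<^sub>+\<^sub>1\<close>.\<close>

definition greedy_strategy :: "'a set \<Rightarrow> ('a list \<Rightarrow> real) \<Rightarrow> nat \<Rightarrow> 'a list \<Rightarrow> bool" where
  "greedy_strategy A f K gs \<longleftrightarrow>
     length gs = K \<and>
     (\<forall>i<K. is_arg_max (\<lambda>g. f (take i gs @ [g])) (\<lambda>g. g \<in> A) (gs ! i))"

definition K_monotone :: "'a set \<Rightarrow> ('a list \<Rightarrow> real) \<Rightarrow> nat \<Rightarrow> bool" where
  "K_monotone A f K \<longleftrightarrow>
     (\<forall>M\<in>lists A. \<forall>N\<in>lists A. length M + length N \<le> K \<longrightarrow> f (M @ N) \<ge> f M)"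

definition K_diminishing :: "'a set \<Rightarrow> ('a list \<Rightarrow> real) \<Rightarrow> nat \<Rightarrow> bool" where
  "K_diminishing A f K \<longleftrightarrow>
     (\<forall>M\<in>lists A. \<forall>N\<in>lists A. \<forall>a\<in>A. prefix M N \<and> length N \<le> K - 1 \<longrightarrow>
        f (M @ [a]) - f M \<ge> f (N @ [a]) - f N)"

definition K_submodular :: "'a set \<Rightarrow> ('a list \<Rightarrow> real) \<Rightarrow> nat \<Rightarrow> bool" where
  "K_submodular A f K \<longleftrightarrow> K_monotone A f K \<and> K_diminishing A f K"

definition K_GO_concave :: "('a list \<Rightarrow> real) \<Rightarrow> nat \<Rightarrow> 'a list \<Rightarrow> 'a list \<Rightarrow> bool" where
  "K_GO_concave f K os gs \<longleftrightarrow>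
     (\<forall>i\<in>{1..K - 1}.
        f (take i gs @ drop i os) \<ge>
          real i / real K * f (take i gs) + (1 - real i / real K) * f os)"

text \<open>
  Division by zero is harmless for \<open>i \<in> {1, \<dots>, K - 1}\<close>: if \<open>f\<close> is \<open>K\<close>-submodular with
  \<^term>\<open>f [] \<ge> 0\<close> and \<open>f\<close> vanishes at some \<open>G\<^sub>i\<close>, then it vanishes at every \<open>G\<^sub>i\<close>, so all
  these terms are \<open>0\<close>, which a positive curvature excludes.
\<close>

definition curvature_term :: "('a list \<Rightarrow> real) \<Rightarrow> nat \<Rightarrow> 'a list \<Rightarrow> 'a list \<Rightarrow> nat \<Rightarrow> real" where
  "curvature_term f K os gs i =
     (real K * f (take i gs)
        - (real K * f (take i gs @ drop i os) - (real K - real i) * f os))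
     / ((real K - real i) * f (take i gs))"

text \<open>
  The curvature is a maximum over \<open>{1, \<dots>, K - 1}\<close>, which does not exist for \<open>K = 1\<close>;
  the nonemptiness condition keeps the unspecified value \<^term>\<open>Max {}\<close> from being used.
\<close>

definition is_curvature :: "('a list \<Rightarrow> real) \<Rightarrow> nat \<Rightarrow> 'a list \<Rightarrow> 'a list \<Rightarrow> real \<Rightarrow> bool" where
  "is_curvature f K os gs \<eta> \<longleftrightarrow>
     {1..K - 1} \<noteq> {} \<and> \<eta> = Max (curvature_term f K os gs ` {1..K - 1})"

end

theory Submission
  imports Defs
begin

text \<open>
  Write \<open>G\<^sub>i\<close> for \<^term>\<open>take i gs\<close>. Appending the tail \<^term>\<open>drop i os\<close> to \<open>G\<^sub>i\<close> can be compared
  with a single greedy step in two ways. From above, diminishing returns bound each of the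
  \<open>K - i\<close> increments by what the same action gains directly after \<open>G\<^sub>i\<close>, hence by the greedy gain
  \<open>f G\<^sub>i\<^sub>+\<^sub>1 - f G\<^sub>i\<close> (\<open>append_gain_le_length_times_step\<close>). From below, the curvature, being at least
  the \<open>i\<close>-th term, says exactly that the total gain is at least
  \<open>(1 - i / K) * (f os - \<eta> * f G\<^sub>i)\<close> (\<open>curvature_term_leD\<close>). The factor \<open>K - i\<close> cancels and leaves
  the recursion \<open>f G\<^sub>i\<^sub>+\<^sub>1 \<ge> (1 - \<eta> / K) * f G\<^sub>i + f os / K\<close>, whose solution from a nonnegative start
  is the bound asserted (\<open>affine_recursion_lower_bound\<close>).

  Two points need care. The curvature says nothing about the index \<open>0\<close>. There the tail is all of
  \<open>os\<close>, so the upper comparison alone gives \<open>f G\<^sub>1 \<ge> (1 - 1 / K) * f [] + f os / K\<close>, which for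
  \<open>\<eta> < 1\<close> and \<open>f [] > 0\<close> is weaker than the recursion. Discarding the nonnegative multiple of
  \<open>f []\<close> leaves \<open>f G\<^sub>1 \<ge> f os / K\<close>, which is the recursion started from \<open>0\<close>, and that start
  suffices. Reading the curvature terms as inequalities needs
  \<open>f G\<^sub>i > 0\<close> for \<open>i \<ge> 1\<close>, which by the same estimate \<open>f G\<^sub>1 \<ge> f os / K\<close> and monotonicity reduces to
  \<open>f os > 0\<close>. A positive curvature guarantees this, since some curvature term must have a nonzero
  denominator. Positivity of \<open>f os\<close> also makes the second inequality of the theorem strict.
\<close>

text \<open>
  Each action of \<open>N\<close> is inserted after an extension of \<open>M\<close>, where it gains at most as much as it
  would directly after \<open>M\<close>.
\<close>

lemma append_gain_le_length_times_step:
  assumes dim: "K_diminishing A f K"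
    and M: "M \<in> lists A"
    and step: "\<And>a. a \<in> A \<Longrightarrow> f (M @ [a]) - f M \<le> d"
    and N: "N \<in> lists A" "length M + length N \<le> K"
  shows "f (M @ N) - f M \<le> real (length N) * d"
  using N
proof (induction N rule: rev_induct)
  case Nil
  then show ?case by simp
next
  case (snoc a N)
  have "f (M @ N @ [a]) - f (M @ N) \<le> f (M @ [a]) - f M"
  proof -
    have "M @ N \<in> lists A" "a \<in> A" "prefix M (M @ N)" "length (M @ N) \<le> K - 1"
      using M snoc.prems by auto
    then have "f ((M @ N) @ [a]) - f (M @ N) \<le> f (M @ [a]) - f M"
      using dim M unfolding K_diminishing_def by blast
    then show ?thesis by simp
  qed
  also have "\<dots> \<le> d"
    using step snoc.prems by simp
  finally show ?case
    using snoc by (simp add: algebra_simps)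
qed

lemma greedy_strategy_in_lists:
  assumes "greedy_strategy A f K gs"
  shows "gs \<in> lists A"
  using assms by (auto simp: greedy_strategy_def is_arg_max_def in_set_conv_nth)

lemma greedy_step_maximal:
  assumes "greedy_strategy A f K gs" "i < K" "a \<in> A"
  shows "f (take i gs @ [a]) \<le> f (take (Suc i) gs)"
  using assms
  by (fastforce simp: greedy_strategy_def is_arg_max_def take_Suc_conv_app_nth not_less)

lemma K_monotone_take:
  assumes mono: "K_monotone A f K" and xs: "xs \<in> lists A" "length xs \<le> K" and "i \<le> j"
  shows "f (take i xs) \<le> f (take j xs)"
proof -
  have split: "take j xs = take i xs @ take (j - i) (drop i xs)"
    using \<open>i \<le> j\<close> by (metis le_add_diff_inverse take_add)
  have "take i xs \<in> lists A" "take (j - i) (drop i xs) \<in> lists A"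
    using xs(1) by (auto dest: in_set_takeD in_set_dropD)
  moreover have "length (take i xs) + length (take (j - i) (drop i xs)) \<le> K"
    using xs(2) by auto
  ultimately show ?thesis
    using mono unfolding K_monotone_def split by blast
qed

text \<open>
  A curvature term measures how far the gain of the optimal tail falls short of the proportional
  share \<open>(1 - i / K) * f os\<close>, in units of the same share of \<^term>\<open>f (take i gs)\<close>.
\<close>

lemma curvature_term_leD:
  assumes "curvature_term f K os gs i \<le> \<eta>" "i < K" "f (take i gs) > 0"
  shows "(real K - real i) * (f os - \<eta> * f (take i gs))
           \<le> real K * (f (take i gs @ drop i os) - f (take i gs))"
proof -
  have "(real K - real i) * f (take i gs) > 0"
    using assms by simp
  then show ?thesis
    using assms(1) unfolding curvature_term_def
    by (simp add: pos_divide_le_eq algebra_simps)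
qed

text \<open>
  Equality in the recursion, from the start \<open>0\<close>, gives the geometric sum
  \<open>b / k * (\<Sum>j<n. (1 - c / k) ^ j)\<close>, and the recursion preserves lower bounds because its factor
  is nonnegative.
\<close>

lemma affine_recursion_lower_bound:
  fixes x :: "nat \<Rightarrow> real"
  assumes "c > 0" "c \<le> k"
    and start: "x 0 \<ge> 0"
    and rec: "\<And>i. i < n \<Longrightarrow> x (Suc i) \<ge> (1 - c / k) * x i + b / k"
  shows "x n \<ge> 1 / c * (1 - (1 - c / k) ^ n) * b"
  using rec
proof (induction n)
  case 0
  then show ?case using start by simp
next
  case (Suc n)
  let ?q = "1 - c / k"
  have q: "?q \<ge> 0" using assms by simp
  have "1 / c * (1 - ?q ^ Suc n) * b = ?q * (1 / c * (1 - ?q ^ n) * b) + b / k"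
    using assms by (simp add: field_simps)
  also have "\<dots> \<le> ?q * x n + b / k"
    using Suc q by (intro add_right_mono mult_left_mono) auto
  also have "\<dots> \<le> x (Suc n)"
    using Suc.prems by simp
  finally show ?case .
qed

lemma one_minus_divide_power_less_exp:
  fixes c :: real
  assumes "c \<noteq> 0" "c \<le> real n" "n > 0"
  shows "(1 - c / real n) ^ n < exp (- c)"
proof -
  have "1 - c / real n < exp (- (c / real n))"
    using exp_minus_greater[of "c / real n"] assms by simp
  moreover have "0 \<le> 1 - c / real n"
    using assms by simp
  ultimately have "(1 - c / real n) ^ n < exp (- (c / real n)) ^ n"
    using assms by (intro power_strict_mono) auto
  also have "\<dots> = exp (- c)"
    using assms by (simp flip: exp_of_nat_mult)
  finally show ?thesis .
qed

theorem theorem4: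
  fixes A :: "'a set" and f :: "'a list \<Rightarrow> real" and K :: nat
    and os gs :: "'a list" and \<eta> :: real
  assumes "K > 0"
    and "f [] \<ge> 0"
    and "optimal_strategy A f K os" and "length os = K"
    and "greedy_strategy A f K gs"
    and "is_curvature f K os gs \<eta>" and "\<eta> \<in> {0<..1}"
    and "K_submodular A f K"
    and "K_GO_concave f K os gs"
  shows "f gs \<ge> 1 / \<eta> * (1 - (1 - \<eta> / real K) ^ K) * f os \<and>
         1 / \<eta> * (1 - (1 - \<eta> / real K) ^ K) * f os > 1 / \<eta> * (1 - exp (- \<eta>)) * f os"
proof -
  define G where "G = (\<lambda>i. take i gs)"
  have mono: "K_monotone A f K" and dim: "K_diminishing A f K"
    using assms by (auto simp: K_submodular_def)
  have gs: "gs \<in> lists A" "length gs = K"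
    using greedy_strategy_in_lists[OF assms(5)] assms(5)
    unfolding greedy_strategy_def by blast+
  have os: "os \<in> lists A"
    using assms by (auto simp: optimal_strategy_def is_arg_max_def)
  have G_lists: "G i \<in> lists A" for i
    using gs by (auto simp: G_def dest: in_set_takeD)
  have G_mono: "f (G i) \<le> f (G j)" if "i \<le> j" for i j
    using K_monotone_take[OF mono] gs that by (simp add: G_def)
  have G_nonneg: "f (G i) \<ge> 0" for i
    using G_mono[of 0 i] assms(2) by (simp add: G_def)
  have G_le_os: "f (G i) \<le> f os" for i
  proof -
    have "length (G i) \<le> K"
      using gs(2) by (simp add: G_def)
    then show ?thesis
      using assms(3) G_lists[of i] unfolding optimal_strategy_def is_arg_max_def
      by (meson not_less)
  qed

  have tail_gain: "f (G i @ drop i os) - f (G i) \<le> (real K - real i) * (f (G (Suc i)) - f (G i))"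
    if "i < K" for i
  proof -
    have "f (G i @ [a]) - f (G i) \<le> f (G (Suc i)) - f (G i)" if "a \<in> A" for a
      using greedy_step_maximal[OF assms(5) \<open>i < K\<close> that] by (simp add: G_def)
    moreover have "drop i os \<in> lists A"
      using os by (auto dest: in_set_dropD)
    moreover have "length (G i) + length (drop i os) \<le> K"
      using that gs(2) assms(4) by (simp add: G_def)
    ultimately have "f (G i @ drop i os) - f (G i)
        \<le> real (length (drop i os)) * (f (G (Suc i)) - f (G i))"
      by (rule append_gain_le_length_times_step[OF dim G_lists])
    then show ?thesis
      using that assms(4) by (simp add: of_nat_diff)
  qed

  have first_step: "f (G 1) \<ge> (1 - 1 / real K) * f (G 0) + f os / real K"
    using tail_gain[of 0] \<open>K > 0\<close> by (simp add: G_def field_simps)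
  have "(1 - 1 / real K) * f (G 0) \<ge> 0"
    using G_nonneg[of 0] \<open>K > 0\<close> by simp
  then have G1: "f (G 1) \<ge> f os / real K"
    using first_step by linarith

  have term_le: "curvature_term f K os gs i \<le> \<eta>" if "i \<in> {1..K - 1}" for i
    using assms(6) that by (auto simp: is_curvature_def)
  have "\<eta> \<in> curvature_term f K os gs ` {1..K - 1}"
    using assms(6) by (auto simp: is_curvature_def intro!: Max_in)
  then obtain i where "curvature_term f K os gs i \<noteq> 0"
    using assms(7) by force
  \<comment> \<open>Division by \<open>0\<close> yields \<open>0\<close>, so a nonzero curvature term has a nonzero denominator.\<close>
  then have "f (G i) \<noteq> 0"
    by (auto simp: curvature_term_def G_def)
  then have os_pos: "f os > 0"
    using G_nonneg[of i] G_le_os[of i] by linarith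
  have G_pos: "f (G i) > 0" if "i \<ge> 1" for i
  proof -
    have "0 < f os / real K" using os_pos \<open>K > 0\<close> by simp
    also have "\<dots> \<le> f (G i)" using G1 G_mono[OF that] by linarith
    finally show ?thesis .
  qed

  \<comment> \<open>The value of the empty string is replaced by \<open>0\<close>, so that the recursion holds at every index
      even though the curvature does not constrain the index \<open>0\<close>.\<close>
  define x where "x = (\<lambda>i. if i = 0 then 0 else f (G i))"
  have rec: "x (Suc i) \<ge> (1 - \<eta> / real K) * x i + f os / real K" if "i < K" for i
  proof (cases "i = 0")
    case True
    then show ?thesis using G1 by (simp add: x_def)
  next
    case False
    have "(real K - real i) * (f os - \<eta> * f (G i)) \<le> real K * (f (G i @ drop i os) - f (G i))"
      using curvature_term_leD[OF term_le, of i] G_pos[of i] False that by (simp add: G_def)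
    also have "\<dots> \<le> real K * ((real K - real i) * (f (G (Suc i)) - f (G i)))"
      using tail_gain[OF that] by (intro mult_left_mono) auto
    finally have "(real K - real i) * (f os - \<eta> * f (G i))
        \<le> (real K - real i) * (real K * (f (G (Suc i)) - f (G i)))"
      by (simp only: mult.left_commute)
    then have "f os - \<eta> * f (G i) \<le> real K * (f (G (Suc i)) - f (G i))"
      using that by simp
    then show ?thesis
      using False \<open>K > 0\<close> by (simp add: x_def field_simps)
  qed
  have "x K \<ge> 1 / \<eta> * (1 - (1 - \<eta> / real K) ^ K) * f os"
    using assms(1,7) rec by (intro affine_recursion_lower_bound) (auto simp: x_def)
  moreover have "x K = f gs"
    using \<open>K > 0\<close> gs by (simp add: x_def G_def)
  moreover have "(1 - \<eta> / real K) ^ K < exp (- \<eta>)"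
    using assms(1,7) by (intro one_minus_divide_power_less_exp) auto
  then have "1 / \<eta> * (1 - (1 - \<eta> / real K) ^ K) * f os > 1 / \<eta> * (1 - exp (- \<eta>)) * f os"
    using assms(7) os_pos by (intro mult_strict_right_mono mult_strict_left_mono) auto
  ultimately show ?thesis by simp
qed

end
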